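(* Let $p$ be a prime and let $n\ge 0$ be an integer. Then, as an identity of polynomials in the variable $t$ over $\mathbb{Q}_p$, $$\frac{(-1)^{n}}{n!}\sum_{k=0}^{n}\binom{n}{k}t^{\,n-k}\int_{\mathbb{Z}_{p}}x_{(k)}\,x_{(n-k)}\,d\mu_{1}(x)=\sum_{k=0}^{n}\boldsymbol{l}(n,k)\,t^{k}.$$
   Context: The Leibnitz numbers are defined for integers $n\ge 0$ and $0\le k\le n$ by $\boldsymbol{l}(n,k)=\dfrac{1}{(n+1)\binom{n}{k}}$. The falling factorial is $x_{(0)}=1$ and $x_{(n)}=x(x-1)\cdots(x-n+1)$ for $n\ge 1$. The Volkenborn integral (bosonic $p$-adic integral) of a uniformly differentiable ($C^1$) function $f$ on $\mathbb{Z}_p$ (in particular, of a polynomial function) is $\int_{\mathbb{Z}_p}f(x)\,d\mu_1(x)=\lim_{N\to\infty}\frac{1}{p^N}\sum_{x=0}^{p^N-1}f(x)$, the limit being taken $p$-adically. *)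

theory Defs
  imports
    "HOL-Analysis.Analysis"
    "HOL-Computational_Algebra.Computational_Algebra"
begin

section \<open>The \<open>p\<close>-adic absolute value on the rationals\<close>

definition padic_abs :: "nat \<Rightarrow> rat \<Rightarrow> real" where
  "padic_abs p x = (if x = 0 then 0 else
     (case quotient_of x of (a, b) \<Rightarrow>
        real p powi (int (multiplicity (int p) b) - int (multiplicity (int p) a))))"

lemma padic_abs_0 [simp]: "padic_abs p 0 = 0"
  by (simp add: padic_abs_def)

lemma padic_abs_divide_of_int:
  assumes p: "prime p" and ab: "a \<noteq> 0" "b \<noteq> 0"
  shows "padic_abs p (of_int a / of_int b) =
    real p powi (int (multiplicity (int p) b) - int (multiplicity (int p) a))"
proof -
  define x :: rat where "x = of_int a / of_int b"
  obtain c d where cd: "quotient_of x = (c, d)" by (cases "quotient_of x")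
  have d: "d > 0" using quotient_of_denom_pos[OF cd] .
  have xcd: "x = of_int c / of_int d" using quotient_of_div[OF cd] .
  have x0: "x \<noteq> 0" using ab by (simp add: x_def)
  have c: "c \<noteq> 0" using x0 xcd by auto
  have "(of_int (a * d) :: rat) = of_int (c * b)"
    using xcd ab d by (simp add: x_def field_simps)
  then have eq: "a * d = c * b" by (simp only: of_int_eq_iff)
  have pe: "prime_elem (int p)" using p by simp
  have "multiplicity (int p) a + multiplicity (int p) d
      = multiplicity (int p) c + multiplicity (int p) b"
    using eq prime_elem_multiplicity_mult_distrib[OF pe, of a d]
      prime_elem_multiplicity_mult_distrib[OF pe, of c b] ab c d by simp
  then have "int (multiplicity (int p) d) - int (multiplicity (int p) c)
      = int (multiplicity (int p) b) - int (multiplicity (int p) a)" by linarith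
  then show ?thesis
    using x0 cd by (simp add: padic_abs_def flip: x_def)
qed

lemma rat_cases_nonzero:
  fixes x :: rat assumes "x \<noteq> 0"
  obtains a b where "x = of_int a / of_int b" "a \<noteq> 0" "b \<noteq> 0"
proof -
  obtain c d where cd: "quotient_of x = (c, d)" by (cases "quotient_of x")
  show ?thesis
    using that[of c d] quotient_of_div[OF cd] quotient_of_denom_pos[OF cd] assms by auto
qed

lemma padic_abs_nonneg [simp]: "padic_abs p x \<ge> 0"
  by (auto simp: padic_abs_def split: prod.split)

lemma padic_abs_eq_0_iff:
  assumes "prime p" shows "padic_abs p x = 0 \<longleftrightarrow> x = 0"
  using prime_gt_0_nat[OF assms] by (auto simp: padic_abs_def split: prod.split)

lemma padic_abs_minus [simp]: "padic_abs p (- x) = padic_abs p x"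
  by (auto simp: padic_abs_def rat_uminus_code split: prod.split)

lemma padic_abs_minus_commute: "padic_abs p (x - y) = padic_abs p (y - x)"
  using padic_abs_minus[of p "x - y"] by simp

lemma padic_abs_1 [simp]: "padic_abs p 1 = 1"
  by (simp add: padic_abs_def)

lemma padic_abs_mult:
  assumes p: "prime p"
  shows "padic_abs p (x * y) = padic_abs p x * padic_abs p y"
proof (cases "x = 0 \<or> y = 0")
  case False
  then have "x \<noteq> 0" "y \<noteq> 0" by auto
  obtain a b where x: "x = of_int a / of_int b" "a \<noteq> 0" "b \<noteq> 0"
    using rat_cases_nonzero[OF \<open>x \<noteq> 0\<close>] .
  obtain c d where y: "y = of_int c / of_int d" "c \<noteq> 0" "d \<noteq> 0"
    using rat_cases_nonzero[OF \<open>y \<noteq> 0\<close>] .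
  have pe: "prime_elem (int p)" using p by simp
  have xy: "x * y = of_int (a * c) / of_int (b * d)" using x y by simp
  have p0: "real p \<noteq> 0" using prime_gt_0_nat[OF p] by simp
  show ?thesis
    unfolding xy unfolding x(1) y(1)
    using x y p0
    by (simp add: padic_abs_divide_of_int[OF p] prime_elem_multiplicity_mult_distrib[OF pe]
        padic_abs_divide_of_int[OF p, of "a * c" "b * d", simplified]
        algebra_simps flip: power_int_add)
qed auto

lemma padic_abs_inverse:
  assumes p: "prime p"
  shows "padic_abs p (inverse x) = inverse (padic_abs p x)"
proof (cases "x = 0")
  case False
  then have "padic_abs p (inverse x) * padic_abs p x = 1"
    by (simp flip: padic_abs_mult[OF p])
  then show ?thesis by (metis inverse_unique mult.commute)
qed simp

lemma padic_abs_add_le_max: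
  assumes p: "prime p"
  shows "padic_abs p (x + y) \<le> max (padic_abs p x) (padic_abs p y)"
proof (cases "x = 0 \<or> y = 0 \<or> x + y = 0")
  case True
  then show ?thesis by (auto simp: le_max_iff_disj)
next
  case False
  then have "x \<noteq> 0" "y \<noteq> 0" and xy0: "x + y \<noteq> 0" by auto
  obtain a b where x: "x = of_int a / of_int b" "a \<noteq> 0" "b \<noteq> 0"
    using rat_cases_nonzero[OF \<open>x \<noteq> 0\<close>] .
  obtain c d where y: "y = of_int c / of_int d" "c \<noteq> 0" "d \<noteq> 0"
    using rat_cases_nonzero[OF \<open>y \<noteq> 0\<close>] .
  define A where "A = a * d"
  define C where "C = c * b"
  define D where "D = b * d"
  have D: "D \<noteq> 0" and A: "A \<noteq> 0" and C: "C \<noteq> 0" using x y by (auto simp: A_def C_def D_def)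
  have xA: "x = of_int A / of_int D" using x y by (simp add: A_def D_def)
  have yC: "y = of_int C / of_int D" using x y by (simp add: C_def D_def)
  have s: "x + y = of_int (A + C) / of_int D" by (simp add: xA yC add_divide_distrib)
  have AC: "A + C \<noteq> 0" using xy0 s by auto
  have nu: "\<not> is_unit (int p)" using prime_gt_1_nat[OF p] by simp
  define m where "m = min (multiplicity (int p) A) (multiplicity (int p) C)"
  have "int p ^ m dvd A + C"
    by (intro dvd_add multiplicity_dvd') (auto simp: m_def)
  then have "m \<le> multiplicity (int p) (A + C)"
    using AC nu by (intro multiplicity_geI) auto
  then have mm: "multiplicity (int p) A \<le> multiplicity (int p) (A + C) \<or>
      multiplicity (int p) C \<le> multiplicity (int p) (A + C)"
    by (auto simp: m_def min_def split: if_splits)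
  have p1: "real p \<ge> 1" using prime_gt_0_nat[OF p] by simp
  show ?thesis
    unfolding s unfolding xA yC padic_abs_divide_of_int[OF p A D]
      padic_abs_divide_of_int[OF p C D] padic_abs_divide_of_int[OF p AC D]
    using mm p1 by (auto simp: le_max_iff_disj intro!: power_int_increasing)
qed

lemma padic_abs_triangle:
  assumes "prime p"
  shows "padic_abs p (x + y) \<le> padic_abs p x + padic_abs p y"
  using padic_abs_add_le_max[OF assms, of x y] padic_abs_nonneg[of p x] padic_abs_nonneg[of p y]
  by linarith

lemma padic_abs_diff_le:
  assumes "prime p"
  shows "\<bar>padic_abs p x - padic_abs p y\<bar> \<le> padic_abs p (x - y)"
  using padic_abs_triangle[OF assms, of "x - y" y] padic_abs_triangle[OF assms, of "y - x" x]
    padic_abs_minus_commute[of p x y]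
  by simp


section \<open>Cauchy and null sequences for the \<open>p\<close>-adic absolute value\<close>

definition padic_cauchy :: "nat \<Rightarrow> (nat \<Rightarrow> rat) \<Rightarrow> bool" where
  "padic_cauchy p X \<longleftrightarrow> (\<forall>e>0. \<exists>M. \<forall>m\<ge>M. \<forall>n\<ge>M. padic_abs p (X m - X n) < e)"

definition padic_null :: "nat \<Rightarrow> (nat \<Rightarrow> rat) \<Rightarrow> bool" where
  "padic_null p X \<longleftrightarrow> (\<lambda>n. padic_abs p (X n)) \<longlonglongrightarrow> 0"

lemma padic_cauchy_iff:
  "padic_cauchy p X \<longleftrightarrow>
    ((\<lambda>z. padic_abs p (X (fst z) - X (snd z))) \<longlongrightarrow> 0) (sequentially \<times>\<^sub>F sequentially)"
  (is "_ \<longleftrightarrow> ?R")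
proof -
  have "?R \<longleftrightarrow> (\<forall>e>0. \<exists>M. \<forall>m\<ge>M. \<forall>n\<ge>M. padic_abs p (X n - X m) < e)"
    by (simp add: tendsto_iff eventually_prod_sequentially)
  then show ?thesis
    by (simp add: padic_cauchy_def padic_abs_minus_commute[of p "X _" "X _"]) 
qed

lemma padic_cauchy_const [simp]: "padic_cauchy p (\<lambda>_. c)"
  by (simp add: padic_cauchy_def)

context
  fixes p :: nat
  assumes p: "prime p"
begin

lemma padic_null_comparison:
  assumes "\<And>n. padic_abs p (X n) \<le> f n" "f \<longlonglongrightarrow> 0"
  shows "padic_null p X"
  unfolding padic_null_def
  by (rule Lim_null_comparison[OF _ assms(2)]) (simp add: assms(1))

lemma padic_cauchy_comparison:
  assumes "\<And>z. padic_abs p (X (fst z) - X (snd z)) \<le> f z"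
    and "(f \<longlongrightarrow> 0) (sequentially \<times>\<^sub>F sequentially)"
  shows "padic_cauchy p X"
  unfolding padic_cauchy_iff
  by (rule Lim_null_comparison[OF _ assms(2)]) (simp add: assms(1))

lemma padic_cauchy_abs_convergent:
  assumes "padic_cauchy p X" shows "convergent (\<lambda>n. padic_abs p (X n))"
proof -
  have "Cauchy (\<lambda>n. padic_abs p (X n))"
  proof (rule metric_CauchyI)
    fix e :: real assume "e > 0"
    then obtain M where M: "\<forall>m\<ge>M. \<forall>n\<ge>M. padic_abs p (X m - X n) < e"
      using assms unfolding padic_cauchy_def by blast
    show "\<exists>M. \<forall>m\<ge>M. \<forall>n\<ge>M. dist (padic_abs p (X m)) (padic_abs p (X n)) < e"
      using M padic_abs_diff_le[OF p] unfolding dist_real_def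
      by (meson le_less_trans)
  qed
  then show ?thesis by (simp add: Cauchy_convergent_iff)
qed

lemma padic_cauchy_abs_lim:
  assumes "padic_cauchy p X"
  shows "(\<lambda>n. padic_abs p (X n)) \<longlonglongrightarrow> lim (\<lambda>n. padic_abs p (X n))"
  using padic_cauchy_abs_convergent[OF assms] by (simp add: convergent_LIMSEQ_iff)

lemma padic_cauchy_abs_lim_fst:
  assumes "padic_cauchy p X"
  shows "((\<lambda>z. padic_abs p (X (fst z))) \<longlongrightarrow> lim (\<lambda>n. padic_abs p (X n)))
    (sequentially \<times>\<^sub>F sequentially)"
  by (rule filterlim_compose[OF padic_cauchy_abs_lim[OF assms] filterlim_fst])

lemma padic_cauchy_abs_lim_snd:
  assumes "padic_cauchy p X"
  shows "((\<lambda>z. padic_abs p (X (snd z))) \<longlongrightarrow> lim (\<lambda>n. padic_abs p (X n)))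
    (sequentially \<times>\<^sub>F sequentially)"
  by (rule filterlim_compose[OF padic_cauchy_abs_lim[OF assms] filterlim_snd])

lemma padic_null_add:
  assumes "padic_null p X" "padic_null p Y"
  shows "padic_null p (\<lambda>n. X n + Y n)"
proof (rule padic_null_comparison)
  show "(\<lambda>n. padic_abs p (X n) + padic_abs p (Y n)) \<longlonglongrightarrow> 0"
    using tendsto_add[OF assms[unfolded padic_null_def]] by simp
qed (rule padic_abs_triangle[OF p])

lemma padic_null_minus: "padic_null p X \<Longrightarrow> padic_null p (\<lambda>n. - X n)"
  by (simp add: padic_null_def)

lemma padic_null_diff:
  "padic_null p X \<Longrightarrow> padic_null p Y \<Longrightarrow> padic_null p (\<lambda>n. X n - Y n)"
  using padic_null_add[OF _ padic_null_minus, of X Y] by simp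

lemma padic_cauchy_add:
  assumes "padic_cauchy p X" "padic_cauchy p Y"
  shows "padic_cauchy p (\<lambda>n. X n + Y n)"
proof (rule padic_cauchy_comparison)
  show "((\<lambda>z. padic_abs p (X (fst z) - X (snd z)) + padic_abs p (Y (fst z) - Y (snd z))) \<longlongrightarrow> 0)
      (sequentially \<times>\<^sub>F sequentially)"
    using tendsto_add[OF assms[unfolded padic_cauchy_iff]] by simp
  show "padic_abs p (X (fst z) + Y (fst z) - (X (snd z) + Y (snd z))) \<le>
      padic_abs p (X (fst z) - X (snd z)) + padic_abs p (Y (fst z) - Y (snd z))" for z
    using padic_abs_triangle[OF p, of "X (fst z) - X (snd z)" "Y (fst z) - Y (snd z)"]
    by (simp add: algebra_simps)
qed

lemma padic_cauchy_minus: "padic_cauchy p X \<Longrightarrow> padic_cauchy p (\<lambda>n. - X n)"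
  using padic_abs_minus[of p "X _ - X _"]
  by (simp add: padic_cauchy_def padic_abs_minus_commute)

lemma padic_abs_mult_diff_le:
  "padic_abs p (a * b - c * d) \<le>
     padic_abs p a * padic_abs p (b - d) + padic_abs p d * padic_abs p (a - c)"
proof -
  have "a * b - c * d = a * (b - d) + d * (a - c)" by (simp add: algebra_simps)
  then show ?thesis
    using padic_abs_triangle[OF p, of "a * (b - d)" "d * (a - c)"]
    by (simp add: padic_abs_mult[OF p])
qed

lemma padic_cauchy_mult:
  assumes "padic_cauchy p X" "padic_cauchy p Y"
  shows "padic_cauchy p (\<lambda>n. X n * Y n)"
proof (rule padic_cauchy_comparison)
  show "((\<lambda>z. padic_abs p (X (fst z)) * padic_abs p (Y (fst z) - Y (snd z)) +
      padic_abs p (Y (snd z)) * padic_abs p (X (fst z) - X (snd z))) \<longlongrightarrow> 0)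
      (sequentially \<times>\<^sub>F sequentially)"
    using tendsto_add[OF
      tendsto_mult[OF padic_cauchy_abs_lim_fst[OF assms(1)] assms(2)[unfolded padic_cauchy_iff]]
      tendsto_mult[OF padic_cauchy_abs_lim_snd[OF assms(2)] assms(1)[unfolded padic_cauchy_iff]]]
    by simp
qed (rule padic_abs_mult_diff_le)

lemma padic_null_mult_diff:
  assumes "padic_cauchy p X" "padic_cauchy p Y'"
    and "padic_null p (\<lambda>n. X n - X' n)" "padic_null p (\<lambda>n. Y n - Y' n)"
  shows "padic_null p (\<lambda>n. X n * Y n - X' n * Y' n)"
proof (rule padic_null_comparison)
  show "(\<lambda>n. padic_abs p (X n) * padic_abs p (Y n - Y' n) +
      padic_abs p (Y' n) * padic_abs p (X n - X' n)) \<longlonglongrightarrow> 0"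
    using tendsto_add[OF
      tendsto_mult[OF padic_cauchy_abs_lim[OF assms(1)] assms(4)[unfolded padic_null_def]]
      tendsto_mult[OF padic_cauchy_abs_lim[OF assms(2)] assms(3)[unfolded padic_null_def]]]
    by simp
qed (rule padic_abs_mult_diff_le)

lemma padic_null_diff_lim:
  assumes "padic_cauchy p X" "padic_null p (\<lambda>n. X n - Y n)"
  shows "lim (\<lambda>n. padic_abs p (X n)) = lim (\<lambda>n. padic_abs p (Y n))"
proof -
  have "(\<lambda>n. padic_abs p (Y n) - padic_abs p (X n)) \<longlonglongrightarrow> 0"
    by (rule Lim_null_comparison[OF _ assms(2)[unfolded padic_null_def]])
       (simp add: padic_abs_diff_le[OF p] padic_abs_minus_commute[of p "X _"])
  from tendsto_add[OF this padic_cauchy_abs_lim[OF assms(1)]]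
  have "(\<lambda>n. padic_abs p (Y n)) \<longlonglongrightarrow> lim (\<lambda>n. padic_abs p (X n))" by simp
  then show ?thesis by (simp add: limI)
qed

lemma padic_null_iff_lim:
  assumes "padic_cauchy p X"
  shows "padic_null p X \<longleftrightarrow> lim (\<lambda>n. padic_abs p (X n)) = 0"
  using padic_cauchy_abs_lim[OF assms] unfolding padic_null_def by (auto dest: limI)

lemma padic_not_null_eventually:
  assumes "padic_cauchy p X" "\<not> padic_null p X"
  shows "eventually (\<lambda>n. X n \<noteq> 0) sequentially"
proof -
  have "eventually (\<lambda>n. padic_abs p (X n) \<noteq> 0) sequentially"
    using assms padic_null_iff_lim by (intro tendsto_imp_eventually_ne[OF padic_cauchy_abs_lim]) auto
  then show ?thesis by (simp add: padic_abs_eq_0_iff[OF p])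
qed

lemma padic_abs_inverse_diff:
  assumes "x \<noteq> 0" "y \<noteq> 0"
  shows "padic_abs p (inverse x - inverse y) =
    padic_abs p (x - y) * inverse (padic_abs p x) * inverse (padic_abs p y)"
proof -
  have "inverse x - inverse y = - ((x - y) * inverse x * inverse y)"
    using assms by (simp add: field_simps)
  then have "padic_abs p (inverse x - inverse y) = padic_abs p ((x - y) * inverse x * inverse y)"
    by (simp only: padic_abs_minus)
  then show ?thesis by (simp add: padic_abs_mult[OF p] padic_abs_inverse[OF p])
qed

lemma padic_cauchy_inverse:
  assumes X: "padic_cauchy p X" "\<not> padic_null p X"
  shows "padic_cauchy p (\<lambda>n. inverse (X n))"
proof -
  let ?F = "sequentially \<times>\<^sub>F sequentially" and ?L = "lim (\<lambda>n. padic_abs p (X n))"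
  have L: "?L \<noteq> 0" using X padic_null_iff_lim by blast
  have "((\<lambda>z. padic_abs p (X (fst z) - X (snd z)) * inverse (padic_abs p (X (fst z))) *
      inverse (padic_abs p (X (snd z)))) \<longlongrightarrow> 0 * inverse ?L * inverse ?L) ?F"
    using X(1) L
    by (intro tendsto_mult tendsto_inverse padic_cauchy_abs_lim_fst padic_cauchy_abs_lim_snd)
       (auto simp: padic_cauchy_iff)
  moreover have "eventually (\<lambda>z. padic_abs p (X (fst z) - X (snd z)) *
      inverse (padic_abs p (X (fst z))) * inverse (padic_abs p (X (snd z))) =
      padic_abs p (inverse (X (fst z)) - inverse (X (snd z)))) ?F"
    using eventually_prodI[OF padic_not_null_eventually[OF X] padic_not_null_eventually[OF X]]
    by eventually_elim (simp add: padic_abs_inverse_diff)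
  ultimately show ?thesis
    unfolding padic_cauchy_iff by (simp add: tendsto_cong)
qed

lemma padic_null_inverse_diff:
  assumes X: "padic_cauchy p X" "\<not> padic_null p X" and Y: "padic_cauchy p Y" "\<not> padic_null p Y"
    and XY: "padic_null p (\<lambda>n. X n - Y n)"
  shows "padic_null p (\<lambda>n. inverse (X n) - inverse (Y n))"
proof -
  let ?L = "lim (\<lambda>n. padic_abs p (X n))" and ?M = "lim (\<lambda>n. padic_abs p (Y n))"
  have L: "?L \<noteq> 0" "?M \<noteq> 0" using X Y padic_null_iff_lim by blast+
  have "(\<lambda>n. padic_abs p (X n - Y n) * inverse (padic_abs p (X n)) *
      inverse (padic_abs p (Y n))) \<longlonglongrightarrow> 0 * inverse ?L * inverse ?M"
    using X(1) Y(1) XY L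
    by (intro tendsto_mult tendsto_inverse padic_cauchy_abs_lim) (auto simp: padic_null_def)
  moreover have "eventually (\<lambda>n. padic_abs p (X n - Y n) *
      inverse (padic_abs p (X n)) * inverse (padic_abs p (Y n)) =
      padic_abs p (inverse (X n) - inverse (Y n))) sequentially"
    using padic_not_null_eventually[OF X] padic_not_null_eventually[OF Y]
    by eventually_elim (simp add: padic_abs_inverse_diff)
  ultimately show ?thesis
    unfolding padic_null_def by (simp add: tendsto_cong)
qed

end


section \<open>The field of \<open>p\<close>-adic numbers\<close>

text \<open>The prime is carried by a type: \<open>p = CARD('p)\<close>, so that \<open>'p padic\<close> is
  \<open>\<rat>\<^sub>p\<close>, the completion of \<open>\<rat>\<close> for the \<open>p\<close>-adic absolute value, built as Cauchy
  sequences modulo null sequences. The cardinality of an infinite type is \<open>0\<close>, so types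
  of class \<open>prime_card\<close> are finite.\<close>

class prime_card =
  assumes prime_card: "prime CARD('a)"

instance bool :: prime_card
  by standard simp

definition padic_rel :: "'p itself \<Rightarrow> (nat \<Rightarrow> rat) \<Rightarrow> (nat \<Rightarrow> rat) \<Rightarrow> bool" where
  "padic_rel _ X Y \<longleftrightarrow> padic_cauchy CARD('p) X \<and> padic_cauchy CARD('p) Y \<and>
     padic_null CARD('p) (\<lambda>n. X n - Y n)"

lemma padic_rel_refl: "padic_cauchy CARD('p) X \<Longrightarrow> padic_rel TYPE('p) X X"
  by (simp add: padic_rel_def padic_null_def)

lemma part_equivp_padic_rel: "part_equivp (padic_rel TYPE('p::prime_card))"
proof (rule part_equivpI)
  show "\<exists>x. padic_rel TYPE('p) x x"
    using padic_rel_refl[OF padic_cauchy_const, where 'p = 'p] by blast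
  show "symp (padic_rel TYPE('p))"
    by (rule sympI) (simp add: padic_rel_def padic_null_def padic_abs_minus_commute)
  show "transp (padic_rel TYPE('p))"
  proof (rule transpI)
    fix X Y Z assume "padic_rel TYPE('p) X Y" "padic_rel TYPE('p) Y Z"
    then show "padic_rel TYPE('p) X Z"
      using padic_null_add[OF prime_card[where 'a = 'p], of "\<lambda>n. X n - Y n" "\<lambda>n. Y n - Z n"]
      by (simp add: padic_rel_def)
  qed
qed

typedef (overloaded) ('p::prime_card) padic =
  "{C. \<exists>X. padic_cauchy CARD('p) X \<and> C = Collect (padic_rel TYPE('p) X)}"
  using padic_cauchy_const by blast

definition padic_of_seq :: "(nat \<Rightarrow> rat) \<Rightarrow> 'p::prime_card padic" where
  "padic_of_seq X = Abs_padic (Collect (padic_rel TYPE('p) X))"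

definition seq_of_padic :: "'p::prime_card padic \<Rightarrow> nat \<Rightarrow> rat" where
  "seq_of_padic x = (SOME X. X \<in> Rep_padic x)"

lemma padic_of_seq_eq_iff:
  assumes "padic_cauchy CARD('p) X" "padic_cauchy CARD('p) Y"
  shows "(padic_of_seq X :: 'p::prime_card padic) = padic_of_seq Y \<longleftrightarrow>
    padic_null CARD('p) (\<lambda>n. X n - Y n)"
proof -
  have "(padic_of_seq X :: 'p padic) = padic_of_seq Y \<longleftrightarrow>
      Collect (padic_rel TYPE('p) X) = Collect (padic_rel TYPE('p) Y)"
    unfolding padic_of_seq_def using assms by (intro Abs_padic_inject) auto
  also have "\<dots> \<longleftrightarrow> padic_rel TYPE('p) X Y"
    using part_equivp_padic_rel[where 'p = 'p] padic_rel_refl[OF assms(2)]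
    by (metis Collect_inj mem_Collect_eq part_equivp_def)
  finally show ?thesis using assms by (simp add: padic_rel_def)
qed

lemma
  fixes x :: "'p::prime_card padic"
  shows padic_cauchy_seq_of_padic [simp]: "padic_cauchy CARD('p) (seq_of_padic x)"
    and padic_of_seq_of_padic [simp]: "padic_of_seq (seq_of_padic x) = x"
proof -
  obtain X where X: "padic_cauchy CARD('p) X" "Rep_padic x = Collect (padic_rel TYPE('p) X)"
    using Rep_padic[of x] by blast
  have "X \<in> Rep_padic x" using X padic_rel_refl by simp
  then have "seq_of_padic x \<in> Rep_padic x" unfolding seq_of_padic_def by (rule someI[where P = "\<lambda>X. X \<in> _"])
  then have rel: "padic_rel TYPE('p) X (seq_of_padic x)" using X by simp
  then show *: "padic_cauchy CARD('p) (seq_of_padic x)" by (simp add: padic_rel_def)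
  have "padic_of_seq X = x" unfolding padic_of_seq_def by (simp add: Rep_padic_inverse flip: X(2))
  moreover have "(padic_of_seq X :: 'p padic) = padic_of_seq (seq_of_padic x)"
    using padic_of_seq_eq_iff[OF X(1) *] rel by (simp add: padic_rel_def)
  ultimately show "padic_of_seq (seq_of_padic x) = x" by simp
qed

lemma padic_null_seq_of_padic:
  assumes "padic_cauchy CARD('p) X"
  shows "padic_null CARD('p) (\<lambda>n. seq_of_padic (padic_of_seq X :: 'p::prime_card padic) n - X n)"
  using padic_of_seq_eq_iff[OF padic_cauchy_seq_of_padic assms,
      of "padic_of_seq X :: 'p padic"] by simp

lemma padic_cases [cases type: padic]:
  fixes x :: "'p::prime_card padic"
  obtains X where "x = padic_of_seq X" "padic_cauchy CARD('p) X"
  using that[of "seq_of_padic x"] by simp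

instantiation padic :: (prime_card) field
begin

definition zero_padic :: "'a padic" where
  "zero_padic = padic_of_seq (\<lambda>_. 0)"

definition one_padic :: "'a padic" where
  "one_padic = padic_of_seq (\<lambda>_. 1)"

definition plus_padic :: "'a padic \<Rightarrow> 'a padic \<Rightarrow> 'a padic" where
  "plus_padic x y = padic_of_seq (\<lambda>n. seq_of_padic x n + seq_of_padic y n)"

definition uminus_padic :: "'a padic \<Rightarrow> 'a padic" where
  "uminus_padic x = padic_of_seq (\<lambda>n. - seq_of_padic x n)"

definition minus_padic :: "'a padic \<Rightarrow> 'a padic \<Rightarrow> 'a padic" where
  "minus_padic x y = x + - y"

definition times_padic :: "'a padic \<Rightarrow> 'a padic \<Rightarrow> 'a padic" where
  "times_padic x y = padic_of_seq (\<lambda>n. seq_of_padic x n * seq_of_padic y n)"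

definition inverse_padic :: "'a padic \<Rightarrow> 'a padic" where
  "inverse_padic x = (if x = 0 then 0 else padic_of_seq (\<lambda>n. inverse (seq_of_padic x n)))"

definition divide_padic :: "'a padic \<Rightarrow> 'a padic \<Rightarrow> 'a padic" where
  "divide_padic x y = x * inverse y"

lemma padic_of_seq_add:
  assumes "padic_cauchy CARD('a) X" "padic_cauchy CARD('a) Y"
  shows "(padic_of_seq X + padic_of_seq Y :: 'a padic) = padic_of_seq (\<lambda>n. X n + Y n)"
  unfolding plus_padic_def
  using padic_null_add[OF prime_card padic_null_seq_of_padic[OF assms(1)]
      padic_null_seq_of_padic[OF assms(2)]]
  by (subst padic_of_seq_eq_iff) (simp_all add: padic_cauchy_add[OF prime_card] assms add_diff_add)

lemma padic_of_seq_minus: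
  assumes "padic_cauchy CARD('a) X"
  shows "(- padic_of_seq X :: 'a padic) = padic_of_seq (\<lambda>n. - X n)"
  unfolding uminus_padic_def
  using padic_null_minus[OF prime_card padic_null_seq_of_padic[OF assms]]
  by (subst padic_of_seq_eq_iff)
     (simp_all add: padic_cauchy_minus[OF prime_card] assms)

lemma padic_of_seq_mult:
  assumes "padic_cauchy CARD('a) X" "padic_cauchy CARD('a) Y"
  shows "(padic_of_seq X * padic_of_seq Y :: 'a padic) = padic_of_seq (\<lambda>n. X n * Y n)"
  unfolding times_padic_def
  by (subst padic_of_seq_eq_iff)
     (simp_all add: padic_cauchy_mult[OF prime_card] padic_null_mult_diff[OF prime_card]
       padic_null_seq_of_padic assms)

lemma padic_of_seq_eq_0_iff:
  assumes "padic_cauchy CARD('a) X"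
  shows "(padic_of_seq X :: 'a padic) = 0 \<longleftrightarrow> padic_null CARD('a) X"
  unfolding zero_padic_def using assms by (simp add: padic_of_seq_eq_iff)

instance
proof
  fix a b c :: "'a padic"
  show "a + b + c = a + (b + c)"
    by (cases a; cases b; cases c)
       (simp add: padic_of_seq_add padic_cauchy_add[OF prime_card] add.assoc)
  show "a + b = b + a"
    by (simp add: plus_padic_def add.commute)
  show "0 + a = a"
    by (cases a) (simp add: zero_padic_def padic_of_seq_add)
  show "- a + a = 0"
    by (cases a) (simp add: padic_of_seq_minus padic_of_seq_add padic_cauchy_minus[OF prime_card]
        zero_padic_def)
  show "a - b = a + - b"
    by (rule minus_padic_def)
  show "a * b * c = a * (b * c)"
    by (cases a; cases b; cases c)
       (simp add: padic_of_seq_mult padic_cauchy_mult[OF prime_card] mult.assoc)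
  show "a * b = b * a"
    by (simp add: times_padic_def mult.commute)
  show "1 * a = a"
    by (cases a) (simp add: one_padic_def padic_of_seq_mult)
  show "(a + b) * c = a * c + b * c"
    by (cases a; cases b; cases c)
       (simp add: padic_of_seq_mult padic_of_seq_add padic_cauchy_mult[OF prime_card]
         padic_cauchy_add[OF prime_card] distrib_right)
  show "(0::'a padic) \<noteq> 1"
    by (simp add: zero_padic_def one_padic_def padic_of_seq_eq_iff padic_null_def LIMSEQ_const_iff)
  show "inverse a * a = 1" if "a \<noteq> 0"
  proof -
    define X where "X = seq_of_padic a"
    have a: "a = padic_of_seq X" and cX: "padic_cauchy CARD('a) X" by (simp_all add: X_def)
    have nX: "\<not> padic_null CARD('a) X"
      using that a padic_of_seq_eq_0_iff[OF cX] by simp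
    have cI: "padic_cauchy CARD('a) (\<lambda>n. inverse (X n))"
      by (rule padic_cauchy_inverse[OF prime_card cX nX])
    have "eventually (\<lambda>n. padic_abs CARD('a) (inverse (X n) * X n - 1) = 0) sequentially"
      using padic_not_null_eventually[OF prime_card cX nX] by eventually_elim simp
    then have "padic_null CARD('a) (\<lambda>n. inverse (X n) * X n - 1)"
      unfolding padic_null_def by (rule tendsto_eventually)
    then have "padic_of_seq (\<lambda>n. inverse (X n)) * padic_of_seq X = (1 :: 'a padic)"
      by (simp add: one_padic_def padic_of_seq_mult cI cX padic_of_seq_eq_iff
          padic_cauchy_mult[OF prime_card])
    then show ?thesis using that by (simp add: inverse_padic_def X_def)
  qed
  show "a div b = a * inverse b"
    by (rule divide_padic_def)
  show "inverse (0::'a padic) = 0"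
    by (simp add: inverse_padic_def)
qed

end

lemma of_nat_padic: "(of_nat n :: 'p::prime_card padic) = padic_of_seq (\<lambda>_. of_nat n)"
proof (induction n)
  case 0 show ?case by (simp add: zero_padic_def)
next
  case (Suc n) then show ?case by (simp add: one_padic_def padic_of_seq_add)
qed

instance padic :: (prime_card) field_char_0
  by standard (auto intro!: injI simp: of_nat_padic padic_of_seq_eq_iff padic_null_def
      LIMSEQ_const_iff padic_abs_eq_0_iff[OF prime_card])

lemma of_int_padic: "(of_int k :: 'p::prime_card padic) = padic_of_seq (\<lambda>_. of_int k)"
  by (cases k rule: int_diff_cases)
     (simp add: of_nat_padic padic_of_seq_minus padic_of_seq_add flip: add_uminus_conv_diff)

lemma of_rat_padic: "(of_rat q :: 'p::prime_card padic) = padic_of_seq (\<lambda>_. q)"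
proof (cases q)
  case (Fract a b)
  then have "(padic_of_seq (\<lambda>_. q) * of_int b :: 'p padic) = of_int a"
    by (simp add: of_int_padic padic_of_seq_mult Fract_of_int_quotient)
  then show ?thesis using Fract by (simp add: of_rat_rat field_simps)
qed

definition padic_norm :: "'p::prime_card padic \<Rightarrow> real" where
  "padic_norm x = lim (\<lambda>n. padic_abs CARD('p) (seq_of_padic x n))"

lemma padic_norm_of_seq:
  assumes "padic_cauchy CARD('p) X"
  shows "padic_norm (padic_of_seq X :: 'p::prime_card padic) = lim (\<lambda>n. padic_abs CARD('p) (X n))"
  unfolding padic_norm_def
  by (rule padic_null_diff_lim[OF prime_card padic_cauchy_seq_of_padic
        padic_null_seq_of_padic[OF assms]])

lemma padic_norm_eq_0_iff: "padic_norm (x :: 'p::prime_card padic) = 0 \<longleftrightarrow> x = 0"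
  by (cases x) (simp add: padic_norm_of_seq padic_of_seq_eq_0_iff padic_null_iff_lim[OF prime_card])

lemma padic_norm_minus: "padic_norm (- x :: 'p::prime_card padic) = padic_norm x"
  by (cases x) (simp add: padic_of_seq_minus padic_norm_of_seq padic_cauchy_minus[OF prime_card])

lemma padic_norm_triangle: "padic_norm (x + y :: 'p::prime_card padic) \<le> padic_norm x + padic_norm y"
proof (cases x; cases y)
  fix X Y
  assume x: "x = padic_of_seq X" and X: "padic_cauchy CARD('p) X"
    and y: "y = padic_of_seq Y" and Y: "padic_cauchy CARD('p) Y"
  have "lim (\<lambda>n. padic_abs CARD('p) (X n + Y n)) \<le>
      lim (\<lambda>n. padic_abs CARD('p) (X n)) + lim (\<lambda>n. padic_abs CARD('p) (Y n))"
    by (rule tendsto_le[OF sequentially_bot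
          tendsto_add[OF padic_cauchy_abs_lim[OF prime_card X] padic_cauchy_abs_lim[OF prime_card Y]]
          padic_cauchy_abs_lim[OF prime_card padic_cauchy_add[OF prime_card X Y]]])
       (simp add: padic_abs_triangle[OF prime_card])
  then show ?thesis
    using X Y by (simp add: x y padic_of_seq_add padic_norm_of_seq padic_cauchy_add[OF prime_card])
qed

instantiation padic :: (prime_card) metric_space
begin

definition dist_padic :: "'a padic \<Rightarrow> 'a padic \<Rightarrow> real" where
  "dist_padic x y = padic_norm (x - y)"

definition uniformity_padic :: "('a padic \<times> 'a padic) filter" where
  "uniformity_padic = (INF e\<in>{0 <..}. principal {(x, y). dist x y < e})"

definition open_padic :: "'a padic set \<Rightarrow> bool" where
  "open_padic U \<longleftrightarrow> (\<forall>x\<in>U. eventually (\<lambda>(x', y). x' = x \<longrightarrow> y \<in> U) uniformity)"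

instance
proof
  fix x y z :: "'a padic"
  show "dist x y = 0 \<longleftrightarrow> x = y"
    by (simp add: dist_padic_def padic_norm_eq_0_iff)
  show "dist x y \<le> dist x z + dist y z"
    using padic_norm_triangle[of "x - z" "- (y - z)"]
    by (simp add: dist_padic_def padic_norm_minus del: minus_diff_eq)
qed (simp_all add: uniformity_padic_def open_padic_def)

end

lemma padic_norm_of_rat: "padic_norm (of_rat x :: 'p::prime_card padic) = padic_abs CARD('p) x"
  by (simp add: of_rat_padic padic_norm_of_seq)

lemma dist_of_rat_padic: "dist (of_rat x) (of_rat y :: 'p::prime_card padic) = padic_abs CARD('p) (x - y)"
  by (simp only: dist_padic_def padic_norm_of_rat flip: of_rat_diff)


section \<open>Volkenborn integral, falling factorials, Leibnitz numbers\<close>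

text \<open>The integral only sees the values of \<open>f\<close> on the natural numbers, which lie in
  \<open>\<int>\<^sub>p\<close>; \<open>lim\<close> is the limit in the \<open>p\<close>-adic metric and is unspecified for \<open>f\<close> for which
  the limit does not exist.\<close>

definition volkenborn :: "('p::prime_card padic \<Rightarrow> 'p padic) \<Rightarrow> 'p padic" where
  "volkenborn f = lim (\<lambda>N. 1 / of_nat (CARD('p) ^ N) * (\<Sum>x = 0..CARD('p) ^ N - 1. f (of_nat x)))"

definition falling_fact :: "'a::comm_ring_1 \<Rightarrow> nat \<Rightarrow> 'a" where
  "falling_fact x n = (\<Prod>i<n. x - of_nat i)"

definition leibnitz :: "nat \<Rightarrow> nat \<Rightarrow> rat" where
  "leibnitz n k = 1 / (of_nat (n + 1) * of_nat (n choose k))"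

end

theory Submission
  imports Defs
begin

text \<open>Since \<open>falling_fact x k = fact k * (x gchoose k)\<close>, comparing coefficients reduces the claim to
  \<open>\<integral> (x choose k) * (x choose m) = (-1)^(k+m) * leibnitz (k+m) k\<close>. Call the left-hand side \<open>I k m\<close>.
  The difference operator applied to \<open>(x choose Suc k) * (x choose Suc m)\<close> gives the integrand of
  \<open>I k m + I (Suc k) m + I k (Suc m)\<close>, and the integral of a difference is the derivative at \<open>0\<close>, which
  vanishes because of the double zero there. This is, up to sign, the Pascal-type recurrence of
  the Leibnitz numbers, and \<open>I k 0 = (-1)^k / (k+1)\<close> follows from the hockey-stick identity.
  All Riemann sums are rational, so convergence is established for the
  \<open>p\<close>-adic absolute value on \<open>\<rat>\<close>.\<close>

lemma leibnitz_fact: "leibnitz (k + m) k = fact k * fact m / fact (Suc (k + m))"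
proof -
  have "fact k * fact m * ((k + m) choose k) = (fact (k + m) :: nat)"
    using binomial_fact_lemma[of k "k + m"] by simp
  then have *: "fact (k + m) = (fact k * fact m * of_nat ((k + m) choose k) :: rat)"
    by (metis of_nat_fact of_nat_mult)
  show ?thesis
    unfolding leibnitz_def fact_Suc * by (simp add: divide_simps del: of_nat_Suc of_nat_add)
qed

text \<open>Each entry of the Leibniz harmonic triangle is the sum of the two entries below it. The
  rule is solved for the entry with larger second parameter so that it drives an induction on
  \<open>m\<close>.\<close>

lemma leibnitz_rec:
  "leibnitz (k + Suc m) k = leibnitz (k + m) k - leibnitz (Suc k + m) (Suc k)"
  unfolding leibnitz_fact by (simp add: field_simps del: of_nat_Suc) (simp add: algebra_simps)

lemma leibnitz_symmetric: "k \<le> n \<Longrightarrow> leibnitz n (n - k) = leibnitz n k"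
  by (simp add: leibnitz_def binomial_symmetric[of k n])

lemma falling_fact_of_nat:
  "falling_fact (of_nat x :: 'a::field_char_0) k = of_nat (fact k * (x choose k))"
  by (simp add: falling_fact_def binomial_gbinomial gbinomial_prod_rev atLeast0LessThan)

lemma padic_abs_of_int_le_1:
  assumes "prime p"
  shows "padic_abs p (of_int a) \<le> 1"
proof (cases "a = 0")
  case False
  have "real p powi (- int (multiplicity (int p) a)) \<le> real p powi 0"
    using prime_ge_1_nat[OF assms] by (intro power_int_increasing) auto
  then show ?thesis
    using padic_abs_divide_of_int[OF assms False, of 1] by simp
qed simp

lemma padic_abs_of_nat_le_1: "prime p \<Longrightarrow> padic_abs p (of_nat a) \<le> 1"
  using padic_abs_of_int_le_1[of p "int a"] by simp

lemma padic_abs_of_nat_divide_le: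
  assumes "prime p"
  shows "padic_abs p (of_nat a / c) \<le> padic_abs p (inverse c)"
  unfolding divide_inverse padic_abs_mult[OF assms]
  by (intro mult_left_le_one_le padic_abs_nonneg padic_abs_of_nat_le_1 assms)

lemma padic_null_mult_bounded:
  assumes "prime p" "padic_null p X" "\<And>n. padic_abs p (Y n) \<le> B"
  shows "padic_null p (\<lambda>n. X n * Y n)"
proof (rule padic_null_comparison[OF assms(1)])
  show "(\<lambda>n. padic_abs p (X n) * B) \<longlonglongrightarrow> 0"
    using tendsto_mult_right[OF assms(2)[unfolded padic_null_def], of B] by simp
  show "padic_abs p (X n * Y n) \<le> padic_abs p (X n) * B" for n
    by (simp add: padic_abs_mult[OF assms(1)] mult_left_mono assms(3))
qed

lemma padic_null_power:
  assumes "prime p"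
  shows "padic_null p (\<lambda>N. of_nat (p ^ N))"
proof -
  have abs_power: "padic_abs p (of_nat (p ^ N)) = padic_abs p (of_nat p) ^ N" for N
    by (induction N) (simp_all add: padic_abs_mult[OF assms])
  have "multiplicity (int p) (int p) = 1"
    using prime_gt_1_nat[OF assms] by (intro multiplicity_self) auto
  then have "padic_abs p (of_nat p) = inverse (real p)"
    using padic_abs_divide_of_int[OF assms, of "int p" 1] prime_gt_1_nat[OF assms]
    by (simp add: power_int_minus)
  then have "padic_abs p (of_nat p) < 1"
    using prime_gt_1_nat[OF assms] by (simp add: inverse_less_1_iff)
  then show ?thesis
    unfolding padic_null_def abs_power by (intro LIMSEQ_realpow_zero) auto
qed

text \<open>Isolates a factor \<open>q\<close>: for \<open>q = p ^ N\<close> it is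
  \<open>p\<close>-adically small, and in a Riemann sum it cancels the division by
  \<open>q\<close>.\<close>

lemma binomial_absorption_div:
  assumes "q > 0"
  shows "of_nat (q choose Suc k) = (of_nat q * (of_nat ((q - 1) choose k) / of_nat (Suc k)) :: rat)"
proof -
  have "Suc k * (q choose Suc k) = q * ((q - 1) choose k)"
    using binomial_absorption[of k q] by simp
  then have "of_nat (Suc k) * of_nat (q choose Suc k) = (of_nat q * of_nat ((q - 1) choose k) :: rat)"
    by (metis of_nat_mult)
  then show ?thesis
    by (simp add: field_simps del: of_nat_Suc)
qed

lemma padic_null_power_choose_Suc:
  assumes "prime p"
  shows "padic_null p (\<lambda>N. of_nat ((p ^ N) choose Suc k))"
proof -
  have *: "of_nat ((p ^ N) choose Suc k)
      = (of_nat (p ^ N) * (of_nat ((p ^ N - 1) choose k) / of_nat (Suc k)) :: rat)" for N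
    using prime_gt_0_nat[OF assms] by (intro binomial_absorption_div) simp
  show ?thesis
    \<comment> \<open>The cofactor stays bounded: its absolute value is at most that of
      \<open>inverse (of_nat (Suc k))\<close>, whatever \<open>N\<close> is.\<close>
    unfolding *
    by (rule padic_null_mult_bounded[OF assms padic_null_power[OF assms]
          padic_abs_of_nat_divide_le[OF assms]])
qed

text \<open>Heuristically \<open>p ^ N - 1\<close> tends to \<open>-1\<close>, and \<open>-1\<close>
  choose \<open>k\<close> is \<open>(- 1) ^ k\<close>. Pascal's rule in row \<open>p ^ N\<close>
  replaces a continuity argument.\<close>

lemma padic_null_power_minus_one_choose:
  assumes "prime p"
  shows "padic_null p (\<lambda>N. of_nat ((p ^ N - 1) choose k) - (- 1) ^ k)"
proof (induction k)
  case 0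
  show ?case by (simp add: padic_null_def)
next
  case (Suc k)
  have eq: "of_nat ((p ^ N - 1) choose Suc k) - (- 1) ^ Suc k
      = (of_nat ((p ^ N) choose Suc k) - (of_nat ((p ^ N - 1) choose k) - (- 1) ^ k) :: rat)" for N
    using prime_gt_0_nat[OF assms] binomial_Suc_Suc[of "p ^ N - 1" k]
    by simp
  show ?case
    unfolding eq by (intro padic_null_diff padic_null_power_choose_Suc assms Suc.IH)
qed

definition volkenborn_sum :: "nat \<Rightarrow> nat \<Rightarrow> nat \<Rightarrow> rat" where
  "volkenborn_sum k m q = (\<Sum>x<q. of_nat ((x choose k) * (x choose m))) / of_nat q"

lemma sum_choose_lessThan: "(\<Sum>x<q. x choose k) = q choose Suc k"
  by (induction q) simp_all

lemma volkenborn_sum_0: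
  assumes "q > 0"
  shows "volkenborn_sum k 0 q = of_nat ((q - 1) choose k) / of_nat (Suc k)"
proof -
  have "(\<Sum>x<q. of_nat ((x choose k) * (x choose 0))) = (of_nat (q choose Suc k) :: rat)"
    unfolding sum_choose_lessThan[symmetric] by simp
  then show ?thesis
    using assms by (simp add: volkenborn_sum_def binomial_absorption_div[OF assms] del: of_nat_Suc)
qed

text \<open>The summand is the forward difference of
  \<open>(x choose Suc k) * (x choose Suc m)\<close>, which vanishes at \<open>x = 0\<close>, so the
  sum telescopes.\<close>

lemma sum_choose_mult_choose:
  "(\<Sum>x<q. (x choose k) * (x choose m) + (x choose Suc k) * (x choose m)
      + (x choose k) * (x choose Suc m)) = (q choose Suc k) * (q choose Suc m)"
  by (induction q) (simp_all add: algebra_simps)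

text \<open>Only one of the two binomials in the telescoped product is used to absorb the division
  by \<open>q\<close>. The other remains and tends to \<open>0\<close> along
  \<open>q = p ^ N\<close>; this is the effect of the double zero.\<close>

lemma volkenborn_sum_Suc:
  assumes "q > 0"
  shows "volkenborn_sum k (Suc m) q =
    of_nat (q choose Suc k) * (of_nat ((q - 1) choose m) / of_nat (Suc m))
      - volkenborn_sum k m q - volkenborn_sum (Suc k) m q"
proof -
  have "volkenborn_sum k m q + volkenborn_sum (Suc k) m q + volkenborn_sum k (Suc m) q
      = of_nat ((q choose Suc k) * (q choose Suc m)) / of_nat q"
    unfolding sum_choose_mult_choose[symmetric] volkenborn_sum_def
    by (simp add: sum.distrib add_divide_distrib)
  also have "\<dots> = of_nat (q choose Suc k) * (of_nat (q choose Suc m) / of_nat q)"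
    by simp
  also have "of_nat (q choose Suc m) / of_nat q = (of_nat ((q - 1) choose m) / of_nat (Suc m) :: rat)"
    using assms by (simp add: binomial_absorption_div[OF assms] del: of_nat_Suc)
  finally show ?thesis
    by (simp add: algebra_simps)
qed

lemma padic_null_volkenborn_sum:
  assumes "prime p"
  shows "padic_null p (\<lambda>N. volkenborn_sum k m (p ^ N) - (- 1) ^ (k + m) * leibnitz (k + m) k)"
\<comment> \<open>\<open>k\<close> must vary, since the recurrence also calls on
  \<open>Suc k\<close>.\<close>
proof (induction m arbitrary: k)
  case 0
  have "volkenborn_sum k 0 (p ^ N) - (- 1) ^ k * leibnitz k k
      = (of_nat ((p ^ N - 1) choose k) - (- 1) ^ k) * inverse (of_nat (Suc k))" for N
    using prime_gt_0_nat[OF assms]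
    by (simp add: volkenborn_sum_0 leibnitz_def divide_inverse algebra_simps)
  then show ?case
    \<comment> \<open>The second factor does not depend on \<open>N\<close>, so
      \<open>order_refl\<close> makes its own absolute value the bound.\<close>
    using padic_null_mult_bounded[OF assms padic_null_power_minus_one_choose[OF assms] order_refl]
    by simp
next
  case (Suc m)
  have null: "padic_null p (\<lambda>N. of_nat ((p ^ N) choose Suc k) *
      (of_nat ((p ^ N - 1) choose m) / of_nat (Suc m)))"
    by (rule padic_null_mult_bounded[OF assms padic_null_power_choose_Suc[OF assms]
          padic_abs_of_nat_divide_le[OF assms]])
  have eq: "volkenborn_sum k (Suc m) (p ^ N) - (- 1) ^ (k + Suc m) * leibnitz (k + Suc m) k
      = of_nat ((p ^ N) choose Suc k) * (of_nat ((p ^ N - 1) choose m) / of_nat (Suc m))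
        - (volkenborn_sum k m (p ^ N) - (- 1) ^ (k + m) * leibnitz (k + m) k)
        - (volkenborn_sum (Suc k) m (p ^ N)
            - (- 1) ^ (Suc k + m) * leibnitz (Suc k + m) (Suc k))" for N
    using prime_gt_0_nat[OF assms] unfolding leibnitz_rec
    by (subst volkenborn_sum_Suc) (simp_all add: algebra_simps del: of_nat_Suc)
  show ?case
    unfolding eq by (intro padic_null_diff assms null Suc.IH)
qed

lemma tendsto_of_rat_padic:
  assumes "padic_null CARD('p) (\<lambda>N. X N - c)"
  shows "(\<lambda>N. of_rat (X N) :: 'p::prime_card padic) \<longlonglongrightarrow> of_rat c"
  using assms by (subst tendsto_dist_iff) (simp add: dist_of_rat_padic padic_null_def)

lemma volkenborn_falling_fact:
  "volkenborn (\<lambda>x :: 'p::prime_card padic. falling_fact x k * falling_fact x m)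
    = fact k * fact m * ((- 1) ^ (k + m) * of_rat (leibnitz (k + m) k))"
proof -
  let ?p = "CARD('p)" and ?c = "fact k * fact m * ((- 1) ^ (k + m) * leibnitz (k + m) k) :: rat"
  have p: "prime ?p"
    by (rule prime_card)
  have of_rat_fact: "of_rat (fact j) = (fact j :: 'p padic)" for j
    by (metis of_nat_fact of_rat_of_nat_eq)
  have "fact k * fact m * volkenborn_sum k m q - ?c
      = (volkenborn_sum k m q - (- 1) ^ (k + m) * leibnitz (k + m) k) * (fact k * fact m)" for q
    by (simp add: algebra_simps)
  then have "padic_null ?p (\<lambda>N. fact k * fact m * volkenborn_sum k m (?p ^ N) - ?c)"
    by (simp only: padic_null_mult_bounded[OF p padic_null_volkenborn_sum[OF p] order_refl])
  then have lim: "(\<lambda>N. of_rat (fact k * fact m * volkenborn_sum k m (?p ^ N)) :: 'p padic)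
      \<longlonglongrightarrow> of_rat ?c"
    by (rule tendsto_of_rat_padic)
  have sum: "1 / of_nat (?p ^ N) * (\<Sum>x = 0..?p ^ N - 1.
        falling_fact (of_nat x) k * falling_fact (of_nat x) m :: 'p padic)
      = of_rat (fact k * fact m * volkenborn_sum k m (?p ^ N))" for N
  proof -
    \<comment> \<open>Positivity matters: with truncated subtraction, \<open>q = 0\<close> would
      give \<open>{0}\<close> on the left.\<close>
    have "{0..q - 1} = {..<q}" if "q > 0" for q :: nat
      using that by auto
    then have "{0..?p ^ N - 1} = {..<?p ^ N}"
      using prime_gt_0_nat[OF p] by (simp del: One_nat_def)
    then show ?thesis
      by (simp add: falling_fact_of_nat volkenborn_sum_def of_rat_mult of_rat_divide of_rat_sum
          of_rat_power of_rat_fact sum_distrib_left sum_divide_distrib mult_ac)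
  qed
  show ?thesis
    unfolding volkenborn_def sum limI[OF lim]
    by (simp only: of_rat_mult of_rat_power of_rat_minus of_rat_1 of_rat_fact)
qed

lemma smult_sum_right: "smult c (\<Sum>i\<in>S. f i) = (\<Sum>i\<in>S. smult c (f i))"
  by (induction S rule: infinite_finite_induct) (simp_all add: smult_add_right)

theorem theorem5p1:
  fixes n :: nat
  shows "smult ((-1) ^ n / fact n)
           (\<Sum>k = 0..n. monom (of_nat (n choose k) *
              volkenborn (\<lambda>x :: 'p::prime_card padic. falling_fact x k * falling_fact x (n - k))) (n - k))
         = (\<Sum>k = 0..n. monom (of_rat (leibnitz n k)) k)"
proof -
  \<comment> \<open>The integral yields \<open>leibnitz n k\<close>; symmetry turns it into
    \<open>leibnitz n (n - k)\<close>, so that the index agrees with the exponent of the monomial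
    and the sum can be reversed.\<close>
  have coeff: "(- 1) ^ n / fact n * (of_nat (n choose k) *
      volkenborn (\<lambda>x :: 'p padic. falling_fact x k * falling_fact x (n - k)))
      = of_rat (leibnitz n (n - k))" if "k \<le> n" for k
  proof -
    have "fact k * fact (n - k) * of_nat (n choose k) = (fact n :: 'p padic)"
      using binomial_fact_lemma[OF that] by (metis of_nat_fact of_nat_mult)
    moreover have "(- 1) ^ n * (- 1) ^ n = (1 :: 'p padic)"
      by (simp flip: power_mult_distrib)
    ultimately show ?thesis
      using that by (simp add: volkenborn_falling_fact leibnitz_symmetric field_simps)
  qed
  have "smult ((-1) ^ n / fact n) (\<Sum>k = 0..n. monom (of_nat (n choose k) *
        volkenborn (\<lambda>x :: 'p padic. falling_fact x k * falling_fact x (n - k))) (n - k))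
      = (\<Sum>k = 0..n. monom (of_rat (leibnitz n (n - k))) (n - k))"
    unfolding smult_sum_right smult_monom by (intro sum.cong refl) (simp only: coeff atLeastAtMost_iff)
  also have "\<dots> = (\<Sum>k = 0..n. monom (of_rat (leibnitz n k)) k)"
    by (subst (2) sum.atLeastAtMost_rev) simp
  finally show ?thesis .
qed

end
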